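(* Let $N\ge1$, let $\mu_1,\dots,\mu_N$ be non-zero real numbers, $\alpha>0$, $\nu_0>0$. For every $\nu\in\{\nu_0+k: k\in\mathbb{N}\}$ (with $\mathbb{N}=\{0,1,2,\dots\}$) let $\delta^{(\nu)}_1,\dots,\delta^{(\nu)}_N>0$ be given and assume there are real coefficients $c^{(\nu)},d^{(\nu)}$ with $$\delta^{(\nu+1)}_k=(d^{(\nu)}k+c^{(\nu)})\,\delta^{(\nu)}_k,\quad 1\le k\le N,\qquad \frac{\mu_{k+1}^2}{\mu_k^2}=d^{(\nu)}k(N-k)\frac{\delta^{(\nu)}_{k+1}}{\delta^{(\nu+1)}_k},\quad 1\le k\le N-1.$$ Assume moreover that $\frac{c^{(\nu)}}{d^{(\nu)}}=\nu+\rho$ for some constant $\rho$ independent of $\nu$ (in particular $d^{(\nu)}\neq0$). Then for every $\nu\in\{\nu_0+k:k\in\mathbb{N}\}$ and every matrix valued $C^2$-function $P$, $$\frac{1}{d^{(\nu)}}\,P\tilde{\mathcal{D}}^{(\alpha,\nu)}=\frac{1}{d^{(\nu+1)}}\,P\mathcal{D}^{(\alpha,\nu+1)}-PD^{(\alpha,\nu+1)}+(\alpha-N-2\nu-2-\rho)\,P.$$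
   Context: The Laguerre polynomials $L_n^{(a)}(x)$ are defined by $(1-t)^{-1-a}\exp\left(\frac{xt}{t-1}\right)=\sum_{n\ge0}L_n^{(a)}(x)t^n$. $L^{(\alpha)}_\mu(x)$ is the $N\times N$ unipotent lower triangular matrix polynomial with $L^{(\alpha)}_\mu(x)_{m,n}=\frac{\mu_m}{\mu_n}L^{(\alpha+n)}_{m-n}(x)$ for $m\ge n$ and $0$ for $m<n$. $A_\mu$ is the $N\times N$ matrix whose only non-zero entries are $(A_\mu)_{k,k-1}=-\mu_k/\mu_{k-1}$, $2\le k\le N$; $J=\mathrm{diag}(1,2,\dots,N)$. Scalars in matrix expressions denote multiples of the identity matrix. The weight is $W^{(\alpha,\nu)}_\mu(x)=L^{(\alpha)}_\mu(x)T^{(\nu)}(x)L^{(\alpha)}_\mu(x)^\ast$, $x>0$, where $T^{(\nu)}(x)$ is the diagonal matrix with $T^{(\nu)}(x)_{k,k}=e^{-x}x^{\nu+k}\delta^{(\nu)}_k$. $\Phi^{(\alpha,\nu)}(x)=(W^{(\alpha,\nu)}_\mu(x))^{-1}W^{(\alpha,\nu+1)}_\mu(x)$ and $\Psi^{(\alpha,\nu)}(x)=(W^{(\alpha,\nu)}_\mu(x))^{-1}\frac{dW^{(\alpha,\nu+1)}_\mu}{dx}(x)$; under the stated conditions these are matrix valued polynomials. Differential operators act from the right on $M_N(\mathbb{C})$-valued $C^2$-functions $P$ on $(0,\infty)$: $P\mathcal{D}^{(\alpha,\nu)}=\frac{d^2P}{dx^2}(\Phi^{(\alpha,\nu)})^\ast+\frac{dP}{dx}(\Psi^{(\alpha,\nu)})^\ast$;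 its Darboux transform (lowering and raising operators interchanged) is $P\tilde{\mathcal{D}}^{(\alpha,\nu)}=\frac{d^2P}{dx^2}(\Phi^{(\alpha,\nu)})^\ast+\frac{dP}{dx}\Bigl(\bigl(\tfrac{d\Phi^{(\alpha,\nu)}}{dx}\bigr)^\ast+(\Psi^{(\alpha,\nu)})^\ast\Bigr)+P\bigl(\tfrac{d\Psi^{(\alpha,\nu)}}{dx}\bigr)^\ast$; and $PD^{(\alpha,\nu)}=\frac{d^2P}{dx^2}\,x+\frac{dP}{dx}\bigl(-x(A_\mu+1)^{-1}+\nu+J+1+(\alpha+J)A_\mu\bigr)+P\bigl((\alpha-\nu)(A_\mu+1)^{-1}-J\bigr)$. *)

theory Defs
  imports "HOL-Analysis.Analysis" "HOL-Computational_Algebra.Formal_Power_Series"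
begin

text \<open>
  An \<open>N \<times> N\<close> matrix is an element of \<open>complex ^ 'n ^ 'n\<close> with \<open>N = CARD('n)\<close>. The order on \<open>'n\<close>
  numbers its elements \<open>1, \<dots>, N\<close>, so that families indexed by \<open>1, \<dots>, N\<close> are functions on \<open>nat\<close>
  that are only evaluated at the values of \<open>idx\<close>.
\<close>

type_synonym 'n sqmat = "((complex, 'n) vec, 'n) vec"

definition idx :: "'n::{finite,linorder} \<Rightarrow> nat"
  where "idx i = card {..i}"

lemma idx_bij_betw: "bij_betw (idx :: 'n::{finite,linorder} \<Rightarrow> nat) UNIV {1..CARD('n)}"
proof -
  have less: "idx i < idx j" if "i < j" for i j :: 'n
    unfolding idx_def using that by (intro psubset_card_mono) auto
  have inj: "inj (idx :: 'n \<Rightarrow> nat)"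
    by (rule injI) (metis less less_irrefl neq_iff)
  have sub: "range (idx :: 'n \<Rightarrow> nat) \<subseteq> {1..CARD('n)}"
    by (auto simp: idx_def Suc_le_eq card_gt_0_iff card_mono)
  have "range (idx :: 'n \<Rightarrow> nat) = {1..CARD('n)}"
    using sub inj by (intro card_subset_eq) (auto simp: card_image)
  with inj show ?thesis
    by (simp add: bij_betw_def)
qed

definition ctranspose :: "complex ^ 'n ^ 'm \<Rightarrow> complex ^ 'm ^ 'n"
  where "ctranspose A = map_matrix cnj (transpose A)"

text \<open>
  \<open>laguerre n a x\<close> is the coefficient of \<open>t ^ n\<close> in the formal power series
  \<open>(1 - t) powr (-1 - a) * exp (x * t / (t - 1))\<close>.
\<close>

definition laguerre :: "nat \<Rightarrow> real \<Rightarrow> real \<Rightarrow> real"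
  where "laguerre n a x =
    fps_nth (fps_compose (fps_binomial (- 1 - a)) (- fps_X) *
             fps_compose (fps_exp x) (fps_X / (fps_X - 1))) n"

definition Lmat :: "(nat \<Rightarrow> real) \<Rightarrow> real \<Rightarrow> real \<Rightarrow> ('n::{finite,linorder}) sqmat"
  where "Lmat \<mu> \<alpha> x =
    (\<chi> m n. if n \<le> m
            then of_real (\<mu> (idx m) / \<mu> (idx n) * laguerre (idx m - idx n) (\<alpha> + real (idx n)) x)
            else 0)"

definition Amat :: "(nat \<Rightarrow> real) \<Rightarrow> ('n::{finite,linorder}) sqmat"
  where "Amat \<mu> =
    (\<chi> k l. if idx k = idx l + 1 then of_real (- \<mu> (idx k) / \<mu> (idx l)) else 0)"

definition Jmat :: "('n::{finite,linorder}) sqmat"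
  where "Jmat = (\<chi> k l. if k = l then of_nat (idx k) else 0)"

text \<open>In the following definitions \<open>\<delta> \<nu> k\<close> stands for \<open>\<delta>\<^bsub>k\<^esub>\<^bsup>(\<nu>)\<^esup>\<close>.\<close>

definition Tmat :: "(real \<Rightarrow> nat \<Rightarrow> real) \<Rightarrow> real \<Rightarrow> real \<Rightarrow> ('n::{finite,linorder}) sqmat"
  where "Tmat \<delta> \<nu> x =
    (\<chi> k l. if k = l then of_real (exp (- x) * x powr (\<nu> + real (idx k)) * \<delta> \<nu> (idx k)) else 0)"

definition Wmat ::
  "(nat \<Rightarrow> real) \<Rightarrow> (real \<Rightarrow> nat \<Rightarrow> real) \<Rightarrow> real \<Rightarrow> real \<Rightarrow> real \<Rightarrow> ('n::{finite,linorder}) sqmat"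
  where "Wmat \<mu> \<delta> \<alpha> \<nu> x = Lmat \<mu> \<alpha> x ** Tmat \<delta> \<nu> x ** ctranspose (Lmat \<mu> \<alpha> x)"

definition mderiv :: "(real \<Rightarrow> ('n::finite) sqmat) \<Rightarrow> real \<Rightarrow> 'n sqmat"
  where "mderiv F x = vector_derivative F (at x)"

definition Phi ::
  "(nat \<Rightarrow> real) \<Rightarrow> (real \<Rightarrow> nat \<Rightarrow> real) \<Rightarrow> real \<Rightarrow> real \<Rightarrow> real \<Rightarrow> ('n::{finite,linorder}) sqmat"
  where "Phi \<mu> \<delta> \<alpha> \<nu> x = matrix_inv (Wmat \<mu> \<delta> \<alpha> \<nu> x) ** Wmat \<mu> \<delta> \<alpha> (\<nu> + 1) x"

definition Psi ::
  "(nat \<Rightarrow> real) \<Rightarrow> (real \<Rightarrow> nat \<Rightarrow> real) \<Rightarrow> real \<Rightarrow> real \<Rightarrow> real \<Rightarrow> ('n::{finite,linorder}) sqmat"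
  where "Psi \<mu> \<delta> \<alpha> \<nu> x = matrix_inv (Wmat \<mu> \<delta> \<alpha> \<nu> x) ** mderiv (Wmat \<mu> \<delta> \<alpha> (\<nu> + 1)) x"

definition C2_on_pos :: "(real \<Rightarrow> ('n::finite) sqmat) \<Rightarrow> bool"
  where "C2_on_pos P \<longleftrightarrow> P C1_differentiable_on {0<..} \<and> mderiv P C1_differentiable_on {0<..}"

text \<open>The operators act from the right: in \<open>opD \<dots> P\<close> and its
  variants the coefficients multiply the derivatives of \<open>P\<close> on the right.\<close>

definition opD ::
  "(nat \<Rightarrow> real) \<Rightarrow> (real \<Rightarrow> nat \<Rightarrow> real) \<Rightarrow> real \<Rightarrow> real \<Rightarrow>
   (real \<Rightarrow> 'n sqmat) \<Rightarrow> real \<Rightarrow> ('n::{finite,linorder}) sqmat"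
  where "opD \<mu> \<delta> \<alpha> \<nu> P x =
    mderiv (mderiv P) x ** ctranspose (Phi \<mu> \<delta> \<alpha> \<nu> x)
    + mderiv P x ** ctranspose (Psi \<mu> \<delta> \<alpha> \<nu> x)"

definition opD_Darboux ::
  "(nat \<Rightarrow> real) \<Rightarrow> (real \<Rightarrow> nat \<Rightarrow> real) \<Rightarrow> real \<Rightarrow> real \<Rightarrow>
   (real \<Rightarrow> 'n sqmat) \<Rightarrow> real \<Rightarrow> ('n::{finite,linorder}) sqmat"
  where "opD_Darboux \<mu> \<delta> \<alpha> \<nu> P x =
    mderiv (mderiv P) x ** ctranspose (Phi \<mu> \<delta> \<alpha> \<nu> x)
    + mderiv P x ** (ctranspose (mderiv (Phi \<mu> \<delta> \<alpha> \<nu>) x) + ctranspose (Psi \<mu> \<delta> \<alpha> \<nu> x))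
    + P x ** ctranspose (mderiv (Psi \<mu> \<delta> \<alpha> \<nu>) x)"

definition opD_Laguerre ::
  "(nat \<Rightarrow> real) \<Rightarrow> real \<Rightarrow> real \<Rightarrow>
   (real \<Rightarrow> 'n sqmat) \<Rightarrow> real \<Rightarrow> ('n::{finite,linorder}) sqmat"
  where "opD_Laguerre \<mu> \<alpha> \<nu> P x =
    x *\<^sub>R mderiv (mderiv P) x
    + mderiv P x ** (- (x *\<^sub>R matrix_inv (Amat \<mu> + mat 1)) + mat (of_real (\<nu> + 1)) + Jmat
                     + (mat (of_real \<alpha>) + Jmat) ** Amat \<mu>)
    + P x ** ((\<alpha> - \<nu>) *\<^sub>R matrix_inv (Amat \<mu> + mat 1) - Jmat)"

end

theory Submission
  imports Defs
begin

text \<open>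
  Put \<open>K\<^sub>\<nu> = J + \<nu> + \<rho>\<close> and let \<open>B\<close> be the matrix whose only non-zero entries are
  \<open>B\<^bsub>k,k+1\<^esub> = - k (N - k) \<mu>\<^sub>k / \<mu>\<^bsub>k+1\<^esub>\<close>. Since \<open>L' = L A\<close>, the conditions on \<open>\<delta>\<close> and \<open>\<mu>\<close> give
  \<open>\<Phi>\<^sup>* = d x L K\<^sub>\<nu> L\<^sup>-\<^sup>1\<close> and \<open>\<Psi>\<^sup>* = d L ((x A + J + \<nu> + 1 - x) K\<^sub>\<nu> + B) L\<^sup>-\<^sup>1\<close>, where \<open>B\<close> does not
  depend on \<open>\<nu>\<close>. Moreover \<open>(L G L\<^sup>-\<^sup>1)' = L ([A, G] + G') L\<^sup>-\<^sup>1\<close>, and contiguity relations of the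
  Laguerre polynomials give \<open>L (1 - A) L\<^sup>-\<^sup>1 = (A + 1)\<^sup>-\<^sup>1\<close> and \<open>L (J + x A) L\<^sup>-\<^sup>1 = J + (\<alpha> + J) A\<close>.
  Hence all coefficients of the three operators are conjugates by \<open>L\<close> of polynomials in \<open>A\<close>, \<open>J\<close>
  and \<open>B\<close>, and these are compared using \<open>[A, J] = - A\<close> and \<open>[A, B] = 2 J - N - 1\<close>.
\<close>

section \<open>Laguerre polynomials\<close>

unbundle no vec_syntax
unbundle fps_syntax

section \<open>The generating function and its derivative in the formal variable\<close>

definition laguerre_gf :: "real \<Rightarrow> real \<Rightarrow> real fps" where
  "laguerre_gf a x =
    fps_compose (fps_binomial (- 1 - a)) (- fps_X) * fps_compose (fps_exp x) (fps_X / (fps_X - 1))"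

lemma laguerre_gf_nth: "laguerre n a x = laguerre_gf a x $ n"
  by (simp add: laguerre_def laguerre_gf_def)

lemma fps_X_div_nth_0 [simp]: "(fps_X / (fps_X - 1 :: real fps)) $ 0 = 0"
  by (simp add: fps_divide_unit)

lemma one_minus_fps_X_mult_div: "(1 - fps_X) * (fps_X / (fps_X - 1)) = (- fps_X :: real fps)"
proof -
  have "(fps_X - 1) * (fps_X / (fps_X - 1)) = (fps_X :: real fps)"
    by (simp add: fps_divide_unit mult.left_commute inverse_mult_eq_1')
  then show ?thesis
    by (simp add: algebra_simps)
qed

text \<open>With u = t/(t-1) this is u' = -1/(1-t)^2 with denominators cleared; it comes from
  differentiating (1-t) u = -t.\<close>

lemma one_minus_fps_X_mult_deriv_div:
  "(1 - fps_X) * ((1 - fps_X) * fps_deriv (fps_X / (fps_X - 1))) = (- 1 :: real fps)"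
proof -
  let ?u = "fps_X / (fps_X - 1) :: real fps"
  have "fps_deriv ((1 - fps_X) * ?u) = - 1"
    unfolding one_minus_fps_X_mult_div by simp
  then have "(1 - fps_X) * fps_deriv ?u = ?u - 1"
    by (simp add: algebra_simps)
  then have "(1 - fps_X) * ((1 - fps_X) * fps_deriv ?u) = (1 - fps_X) * ?u - (1 - fps_X)"
    by (simp only: right_diff_distrib[of "1 - fps_X" ?u] mult_1_right)
  then show ?thesis
    unfolding one_minus_fps_X_mult_div by simp
qed

text \<open>Only the binomial factor depends on \<open>a\<close>, and raising \<open>a\<close> by
  one divides it by 1 - t.\<close>

lemma laguerre_gf_Suc: "(1 - fps_X) * laguerre_gf (a + 1) x = laguerre_gf a x"
proof -
  have "fps_binomial (- 1 - a) = fps_binomial (- 1 - (a + 1)) * fps_binomial 1"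
    by (simp flip: fps_binomial_add_mult)
  then show ?thesis
    by (simp add: laguerre_gf_def fps_compose_mult_distrib fps_binomial_1 fps_compose_add_distrib
        mult_ac)
qed

text \<open>The logarithmic derivative in t is (1+a)/(1-t) - x/(1-t)^2. After multiplication by 1 -
  t, the remaining factor 1/(1-t) in the second term is absorbed by raising the parameter.\<close>

lemma laguerre_gf_deriv:
  "(1 - fps_X) * fps_deriv (laguerre_gf a x)
    = fps_const (1 + a) * laguerre_gf a x - fps_const x * laguerre_gf (a + 1) x"
proof -
  define u :: "real fps" where "u = fps_X / (fps_X - 1)"
  define b where "b = fps_compose (fps_binomial (- 1 - a)) (- fps_X)"
  define e where "e = fps_compose (fps_exp x) u"
  have u0: "u $ 0 = 0"
    by (simp add: u_def)
  have gf: "laguerre_gf a x = b * e"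
    by (simp add: laguerre_gf_def b_def e_def u_def)
  have e': "fps_deriv e = fps_const x * e * fps_deriv u"
    by (simp add: e_def fps_compose_deriv u0 fps_compose_mult_distrib)
  have "(1 + fps_X) * fps_deriv (fps_binomial (- 1 - a)) = fps_const (- 1 - a) * fps_binomial (- 1 - a)"
    by (simp add: fps_binomial_deriv fps_divide_unit mult.left_commute inverse_mult_eq_1')
  then have "fps_compose ((1 + fps_X) * fps_deriv (fps_binomial (- 1 - a))) (- fps_X)
      = fps_compose (fps_const (- 1 - a) * fps_binomial (- 1 - a)) (- fps_X)"
    by (rule arg_cong)
  then have "(1 - fps_X) * fps_compose (fps_deriv (fps_binomial (- 1 - a))) (- fps_X)
      = fps_const (- 1 - a) * b"
    by (simp add: fps_compose_mult_distrib fps_compose_add_distrib b_def del: fps_const_sub)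
  then have b': "(1 - fps_X) * fps_deriv b = fps_const (1 + a) * b"
    by (simp add: b_def fps_compose_deriv algebra_simps flip: fps_const_add fps_const_sub fps_const_neg)
  have "(1 - fps_X) * fps_deriv (laguerre_gf a x)
      = ((1 - fps_X) * fps_deriv b) * e + fps_const x * ((1 - fps_X) * fps_deriv u * (b * e))"
    by (simp add: gf e' algebra_simps)
  also have "(1 - fps_X) * fps_deriv u * (b * e)
      = ((1 - fps_X) * ((1 - fps_X) * fps_deriv u)) * laguerre_gf (a + 1) x"
    by (simp add: mult_ac flip: gf laguerre_gf_Suc[of a x])
  finally show ?thesis
    unfolding b' u_def one_minus_fps_X_mult_deriv_div by (simp add: gf mult_ac)
qed

section \<open>Contiguity relations and the derivative in x\<close>

lemma laguerre_0 [simp]: "laguerre 0 a x = 1"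
  by (simp add: laguerre_def)

lemma laguerre_Suc: "laguerre (Suc n) a x = laguerre (Suc n) (a + 1) x - laguerre n (a + 1) x"
  unfolding laguerre_gf_nth laguerre_gf_Suc[of a x, symmetric] by (simp add: left_diff_distrib)

text \<open>Comparison of the coefficients of t^n on both sides of
  \<open>laguerre_gf_deriv\<close>.\<close>

lemma laguerre_recurrence:
  "real (Suc n) * laguerre (Suc n) a x
    = (a + real (Suc n)) * laguerre n a x - x * laguerre n (a + 1) x"
proof -
  have "((1 - fps_X) * fps_deriv (laguerre_gf a x)) $ n
      = (1 + a) * laguerre n a x - x * laguerre n (a + 1) x"
    unfolding laguerre_gf_deriv by (simp add: laguerre_gf_nth)
  moreover have "((1 - fps_X) * fps_deriv (laguerre_gf a x)) $ n
      = real (Suc n) * laguerre (Suc n) a x - real n * laguerre n a x"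
    by (cases n) (simp_all add: left_diff_distrib laguerre_gf_nth)
  ultimately show ?thesis
    by (simp add: algebra_simps)
qed

text \<open>Each coefficient of exp(x u) is a finite sum of monomials in x, so the rule that d/dx
  multiplies exp(x u) by u can be checked term by term.\<close>

lemma has_real_derivative_fps_exp_compose:
  fixes u :: "real fps"
  assumes "u $ 0 = 0"
  shows "((\<lambda>x. fps_compose (fps_exp x) u $ n) has_real_derivative
    (u * fps_compose (fps_exp x) u) $ n) (at x)"
proof -
  \<comment> \<open>Writing the derivative of x^i/i! as a coefficient of t exp(x t) covers i = 0 as
    well and lets the differentiated sum be read as a composition with \<open>u\<close>.\<close>
  have "((\<lambda>x. (x ^ i / fact i) * (u ^ i $ n)) has_real_derivative
      (fps_X * fps_exp x) $ i * (u ^ i $ n)) (at x)" for i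
  proof (cases i)
    case (Suc j)
    have "((\<lambda>x. x ^ Suc j / fact (Suc j)) has_real_derivative x ^ j / fact j) (at x)"
      by (rule DERIV_cong[OF DERIV_cdivide[OF DERIV_pow]]) (simp add: divide_simps)
    then have "((\<lambda>x. (x ^ Suc j / fact (Suc j)) * (u ^ i $ n)) has_real_derivative
        (x ^ j / fact j) * (u ^ i $ n)) (at x)"
      by (rule DERIV_cmult_right)
    then show ?thesis
      unfolding Suc by (simp del: power_Suc fact_Suc)
  qed simp
  then have "((\<lambda>x. \<Sum>i = 0..n. (x ^ i / fact i) * (u ^ i $ n)) has_real_derivative
      (\<Sum>i = 0..n. (fps_X * fps_exp x) $ i * (u ^ i $ n))) (at x)"
    by (intro DERIV_sum)
  moreover have "u * fps_compose (fps_exp x) u = fps_compose (fps_X * fps_exp x) u"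
    by (simp add: fps_compose_mult_distrib assms)
  ultimately show ?thesis
    by (simp only: fps_compose_nth fps_exp_nth of_nat_fact)
qed

text \<open>Differentiation in x multiplies the generating function by u = t/(t-1). Raising the
  parameter supplies a factor 1 - t, and (1-t) u = -t shifts the degree by one.\<close>

lemma has_real_derivative_laguerre:
  "((\<lambda>x. laguerre (Suc n) a x) has_real_derivative - laguerre n (a + 1) x) (at x)"
proof -
  let ?u = "fps_X / (fps_X - 1) :: real fps"
  let ?b = "fps_compose (fps_binomial (- 1 - a)) (- fps_X)"
  have "((\<lambda>x. \<Sum>i = 0..Suc n. ?b $ i * fps_compose (fps_exp x) ?u $ (Suc n - i)) has_real_derivative
      (\<Sum>i = 0..Suc n. ?b $ i * (?u * fps_compose (fps_exp x) ?u) $ (Suc n - i))) (at x)"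
    by (intro DERIV_sum DERIV_cmult has_real_derivative_fps_exp_compose) simp
  moreover have "(\<Sum>i = 0..Suc n. ?b $ i * (?u * fps_compose (fps_exp x) ?u) $ (Suc n - i))
      = (?u * laguerre_gf a x) $ Suc n"
    unfolding laguerre_gf_def mult.left_commute[of ?u] fps_mult_nth[of ?b] ..
  moreover have "?u * laguerre_gf a x = (1 - fps_X) * ?u * laguerre_gf (a + 1) x"
    by (simp add: mult_ac flip: laguerre_gf_Suc[of a x])
  ultimately show ?thesis
    unfolding laguerre_gf_nth laguerre_gf_def[of a] fps_mult_nth[of ?b]
    by (simp add: one_minus_fps_X_mult_div)
qed

unbundle no fps_syntax
unbundle vec_syntax

section \<open>Complex matrices with real entries\<close>

lemma idx_eq_iff [simp]: "idx i = idx j \<longleftrightarrow> i = j"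
  using bij_betw_imp_inj_on[OF idx_bij_betw] by (rule inj_eq)

lemma idx_less_iff [simp]: "idx i < idx j \<longleftrightarrow> i < j"
proof -
  have "idx i < idx j" if "i < j" for i j :: 'a
    unfolding idx_def using that by (intro psubset_card_mono) auto
  from this[of i j] this[of j i] show ?thesis
    by (cases i j rule: linorder_cases) auto
qed

lemma idx_le_iff [simp]: "idx i \<le> idx j \<longleftrightarrow> i \<le> j"
  by (simp flip: not_less)

lemma idx_range: "idx (i :: 'n::{finite,linorder}) \<in> {1..CARD('n)}"
  using bij_betwE[OF idx_bij_betw] by blast

lemma sum_idx: "(\<Sum>i\<in>UNIV. f (idx (i :: 'n::{finite,linorder}))) = (\<Sum>k = 1..CARD('n). f k)"
  by (rule sum.reindex_bij_betw[OF idx_bij_betw])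

text \<open>Boundedness is automatic in finite dimension; the interpretation supplies the
  distributive laws and the product rule for derivatives.\<close>

interpretation matrix_mult: bounded_bilinear "(**) :: complex ^ 'n ^ 'm \<Rightarrow> complex ^ 'k ^ 'n \<Rightarrow> complex ^ 'k ^ 'm"
  by (intro bilinear_conv_bounded_bilinear[THEN iffD1] bilinear_def[THEN iffD2] conjI allI linearI)
    (simp_all add: vec_eq_iff matrix_matrix_mult_def algebra_simps sum.distrib scaleR_sum_right)

lemmas matrix_distribs = matrix_mult.add_left matrix_mult.add_right matrix_mult.diff_left
  matrix_mult.diff_right matrix_mult.scaleR_left matrix_mult.scaleR_right

lemma ctranspose_nth [simp]: "ctranspose A $ i $ j = cnj (A $ j $ i)"
  by (simp add: ctranspose_def transpose_def)

lemma ctranspose_add: "ctranspose (A + B) = ctranspose A + ctranspose B"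
  and ctranspose_diff: "ctranspose (A - B) = ctranspose A - ctranspose B"
  and ctranspose_scaleR: "ctranspose (r *\<^sub>R A) = r *\<^sub>R ctranspose A"
  by (simp_all add: vec_eq_iff)

lemma bounded_linear_ctranspose:
  "bounded_linear (ctranspose :: complex ^ 'n ^ 'm \<Rightarrow> complex ^ 'm ^ 'n)"
  by (intro linear_conv_bounded_linear[THEN iffD1] linearI)
    (simp_all add: ctranspose_add ctranspose_scaleR)

lemma ctranspose_ctranspose [simp]: "ctranspose (ctranspose A) = A"
  by (simp add: vec_eq_iff)

lemma ctranspose_mult: "ctranspose (A ** B) = ctranspose B ** ctranspose A"
  by (simp add: vec_eq_iff matrix_matrix_mult_def mult.commute)

lemma ctranspose_mat_1 [simp]: "ctranspose (mat 1) = mat 1"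
  by (simp add: vec_eq_iff mat_def)

lemma mat_of_real: "mat (of_real r) = r *\<^sub>R (mat 1 :: complex ^ 'n ^ 'n)"
  by (simp add: vec_eq_iff mat_def scaleR_conv_of_real[where 'a = complex])

text \<open>For square matrices a right inverse is two-sided, so the choice in
  \<open>matrix_inv\<close> is made from a nonempty set, and it can only pick
  \<open>B\<close>.\<close>

lemma matrix_inv_eq:
  fixes A :: "complex ^ 'n ^ 'n"
  assumes "A ** B = mat 1"
  shows "matrix_inv A = B"
proof -
  have BA: "B ** A = mat 1"
    using assms by (rule matrix_left_right_inverse[THEN iffD1])
  have "\<exists>C. A ** C = mat 1 \<and> C ** A = mat 1"
    using assms BA by blast
  from someI_ex[OF this] have "matrix_inv A ** A = mat 1"
    unfolding matrix_inv_def by simp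
  then have "matrix_inv A ** (A ** B) = B"
    by (simp add: matrix_mul_assoc)
  then show ?thesis
    by (simp add: assms)
qed

text \<open>All concrete matrices below have real entries depending on the positions 1, ..., N. This
  form reduces matrix identities to identities between real functions on {1..N}.\<close>

definition rmat :: "(nat \<Rightarrow> nat \<Rightarrow> real) \<Rightarrow> 'n::{finite,linorder} sqmat" where
  "rmat f = (\<chi> i j. of_real (f (idx i) (idx j)))"

abbreviation dmat :: "(nat \<Rightarrow> real) \<Rightarrow> 'n::{finite,linorder} sqmat" where
  "dmat f \<equiv> rmat (\<lambda>i j. if i = j then f i else 0)"

lemma rmat_cong:
  assumes "\<And>i j. i \<in> {1..CARD('n)} \<Longrightarrow> j \<in> {1..CARD('n)} \<Longrightarrow> f i j = g i j"
  shows "rmat f = (rmat g :: 'n::{finite,linorder} sqmat)"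
  by (simp add: rmat_def vec_eq_iff assms[OF idx_range idx_range])

lemma rmat_mult:
  "rmat f ** rmat g = (rmat (\<lambda>i j. \<Sum>k = 1..CARD('n). f i k * g k j) :: 'n::{finite,linorder} sqmat)"
  by (simp add: rmat_def vec_eq_iff matrix_matrix_mult_def del: One_nat_def flip: sum_idx)

lemma rmat_add: "rmat f + rmat g = rmat (\<lambda>i j. f i j + g i j)"
  and rmat_diff: "rmat f - rmat g = rmat (\<lambda>i j. f i j - g i j)"
  and rmat_uminus: "- rmat f = rmat (\<lambda>i j. - f i j)"
  and rmat_scaleR: "r *\<^sub>R rmat f = rmat (\<lambda>i j. r * f i j)"
  and mat_1_eq_rmat: "mat 1 = dmat (\<lambda>_. 1)"
  and ctranspose_rmat: "ctranspose (rmat f) = rmat (\<lambda>i j. f j i)"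
  by (simp_all add: rmat_def vec_eq_iff mat_def scaleR_conv_of_real[where 'a = complex])

lemma rmat_mult_dmat: "rmat f ** dmat g = rmat (\<lambda>i j. f i j * g j)"
  unfolding rmat_mult by (rule rmat_cong) (simp add: mult_delta_right)

lemma dmat_mult_rmat: "dmat g ** rmat f = rmat (\<lambda>i j. g i * f i j)"
  unfolding rmat_mult by (rule rmat_cong) (simp add: mult_delta_left)

text \<open>Expanding in the matrix units \<open>e i j\<close> gives a finite sum with real
  coefficients, which is differentiated term by term.\<close>

lemma has_vector_derivative_rmat:
  assumes "\<And>i j. i \<in> {1..CARD('n)} \<Longrightarrow> j \<in> {1..CARD('n)} \<Longrightarrow>
    ((\<lambda>x. f x i j) has_real_derivative f' i j) F"
  shows "((\<lambda>x. rmat (f x) :: 'n::{finite,linorder} sqmat) has_vector_derivative rmat f') F"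
proof -
  define e :: "'n \<Rightarrow> 'n \<Rightarrow> 'n sqmat" where "e i j = axis i (axis j 1)" for i j
  have e_nth: "(e i j) $ k $ l = (if i = k \<and> j = l then 1 else 0)" for i j k l
    by (auto simp: e_def axis_def)
  have "((\<Sum>i\<in>UNIV. \<Sum>j\<in>UNIV. c i j *\<^sub>R e i j) $ k) $ l
      = (\<Sum>i\<in>UNIV. \<Sum>j\<in>UNIV. if j = l then if i = k then complex_of_real (c i j) else 0 else 0)"
    for c :: "'n \<Rightarrow> 'n \<Rightarrow> real" and k l
    by (simp only: sum_component vector_scaleR_component e_nth, intro sum.cong refl)
      (simp add: scaleR_conv_of_real[where 'a = complex])
  then have rmat_eq: "rmat g = (\<Sum>i\<in>UNIV. \<Sum>j\<in>UNIV. g (idx i) (idx j) *\<^sub>R e i j)" for g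
    by (simp add: vec_eq_iff rmat_def)
  have "((\<lambda>x. f x (idx i) (idx j) *\<^sub>R e i j) has_vector_derivative
      f' (idx i) (idx j) *\<^sub>R e i j) F" for i j
    using assms[OF idx_range idx_range, unfolded has_real_derivative_iff_has_vector_derivative]
    by (rule bounded_linear.has_vector_derivative[OF bounded_linear_scaleR_left])
  then show ?thesis
    unfolding rmat_eq by (intro has_vector_derivative_sum)
qed

section \<open>The matrices of the weight\<close>

lemma Lmat_eq_rmat:
  "Lmat \<mu> \<alpha> x =
    rmat (\<lambda>m n. if n \<le> m then \<mu> m / \<mu> n * laguerre (m - n) (\<alpha> + real n) x else 0)"
  by (simp add: Lmat_def rmat_def vec_eq_iff)

lemma Amat_eq_rmat: "Amat \<mu> = rmat (\<lambda>k l. if k = l + 1 then - \<mu> k / \<mu> l else 0)"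
  by (simp add: Amat_def rmat_def vec_eq_iff)

lemma Jmat_eq_dmat: "Jmat = dmat real"
  by (simp add: Jmat_def rmat_def vec_eq_iff)

lemma Tmat_eq_dmat: "Tmat \<delta> \<nu> x = dmat (\<lambda>k. exp (- x) * x powr (\<nu> + real k) * \<delta> \<nu> k)"
  by (simp add: Tmat_def rmat_def vec_eq_iff)

section \<open>Derivative and contiguity relations of the Laguerre matrix\<close>

lemma rmat_mult_Amat:
  "rmat f ** Amat \<mu> = (rmat (\<lambda>m n. if n < CARD('n) then - f m (n + 1) * \<mu> (n + 1) / \<mu> n else 0)
    :: 'n::{finite,linorder} sqmat)"
  unfolding Amat_eq_rmat rmat_mult
  by (rule rmat_cong) (auto simp: mult_delta_right)

lemma Amat_mult_rmat:
  "Amat \<mu> ** rmat f = (rmat (\<lambda>m n. if 1 < m then - \<mu> m / \<mu> (m - 1) * f (m - 1) n else 0)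
    :: 'n::{finite,linorder} sqmat)"
  unfolding Amat_eq_rmat rmat_mult
proof (rule rmat_cong)
  fix i j
  assume "i \<in> {1..CARD('n)}"
  then obtain k where "i = Suc k" "k < CARD('n)"
    by (cases i) auto
  then show "(\<Sum>k = 1..CARD('n). (if i = k + 1 then - \<mu> i / \<mu> k else 0) * f k j)
      = (if 1 < i then - \<mu> i / \<mu> (i - 1) * f (i - 1) j else 0)"
    by (auto simp: mult_delta_left)
qed

text \<open>Separates entries above, on and below the diagonal; below it m - n becomes
  \<open>Suc k\<close>, the form in which the Laguerre identities are stated.\<close>

lemma nat_less_eq_gt_cases:
  fixes m n :: nat
  obtains "m < n" | "m = n" | k where "m = Suc (n + k)"
  by (metis less_iff_Suc_add linorder_neqE_nat)

text \<open>Differentiating an entry lowers its degree and raises its parameter by one, which is the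
  passage from column n to column n + 1 performed by right multiplication with A.\<close>

lemma has_vector_derivative_Lmat:
  assumes "\<And>k. k \<in> {1..CARD('n)} \<Longrightarrow> \<mu> k \<noteq> 0"
  shows "(Lmat \<mu> \<alpha> has_vector_derivative (Lmat \<mu> \<alpha> x ** Amat \<mu> :: 'n::{finite,linorder} sqmat)) (at x)"
  unfolding Lmat_eq_rmat[abs_def] rmat_mult_Amat
proof (rule has_vector_derivative_rmat)
  fix m n
  assume mn: "m \<in> {1..CARD('n)}" "n \<in> {1..CARD('n)}"
  show "((\<lambda>x. if n \<le> m then \<mu> m / \<mu> n * laguerre (m - n) (\<alpha> + real n) x else 0)
      has_real_derivative
      (if n < CARD('n)
       then - (if n + 1 \<le> m then \<mu> m / \<mu> (n + 1) * laguerre (m - (n + 1)) (\<alpha> + real (n + 1)) x else 0)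
              * \<mu> (n + 1) / \<mu> n
       else 0)) (at x)"
  proof (cases m n rule: nat_less_eq_gt_cases)
    case (3 k)
    then show ?thesis
      using mn assms[of "n + 1"]
        DERIV_cmult[OF has_real_derivative_laguerre[of k "\<alpha> + real n" x], of "\<mu> m / \<mu> n"]
      by (simp add: add_ac)
  qed auto
qed

text \<open>A shifts rows and keeps the parameter \<alpha> + n, so each entry is an instance of
  \<open>laguerre_Suc\<close>.\<close>

lemma Lmat_add_Amat_mult:
  assumes "\<And>k. k \<in> {1..CARD('n)} \<Longrightarrow> \<mu> k \<noteq> 0"
  shows "Lmat \<mu> \<alpha> x + Amat \<mu> ** Lmat \<mu> \<alpha> x = (Lmat \<mu> (\<alpha> - 1) x :: 'n::{finite,linorder} sqmat)"
  unfolding Lmat_eq_rmat Amat_mult_rmat rmat_add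
proof (rule rmat_cong)
  fix m n
  assume mn: "m \<in> {1..CARD('n)}" "n \<in> {1..CARD('n)}"
  show "(if n \<le> m then \<mu> m / \<mu> n * laguerre (m - n) (\<alpha> + real n) x else 0)
      + (if 1 < m then - \<mu> m / \<mu> (m - 1)
          * (if n \<le> m - 1 then \<mu> (m - 1) / \<mu> n * laguerre (m - 1 - n) (\<alpha> + real n) x else 0) else 0)
      = (if n \<le> m then \<mu> m / \<mu> n * laguerre (m - n) (\<alpha> - 1 + real n) x else 0)"
  proof (cases m n rule: nat_less_eq_gt_cases)
    case (3 k)
    have "laguerre (Suc k) (\<alpha> + real n) x
        = laguerre (Suc k) (\<alpha> - 1 + real n) x + laguerre k (\<alpha> + real n) x"
      using laguerre_Suc[of k "\<alpha> - 1 + real n" x] by (simp add: algebra_simps)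
    then show ?thesis
      using 3 mn assms[of "m - 1"] by (simp add: algebra_simps add_divide_distrib)
  qed (use mn in auto)
qed

text \<open>The same relation \<open>laguerre_Suc\<close> read along columns, where the shift also
  raises the parameter.\<close>

lemma Lmat_diff_mult_Amat:
  assumes "\<And>k. k \<in> {1..CARD('n)} \<Longrightarrow> \<mu> k \<noteq> 0"
  shows "Lmat \<mu> (\<alpha> - 1) x - Lmat \<mu> (\<alpha> - 1) x ** Amat \<mu> = (Lmat \<mu> \<alpha> x :: 'n::{finite,linorder} sqmat)"
  unfolding Lmat_eq_rmat rmat_mult_Amat rmat_diff
proof (rule rmat_cong)
  fix m n
  assume mn: "m \<in> {1..CARD('n)}" "n \<in> {1..CARD('n)}"
  show "(if n \<le> m then \<mu> m / \<mu> n * laguerre (m - n) (\<alpha> - 1 + real n) x else 0)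
      - (if n < CARD('n)
         then - (if n + 1 \<le> m
                 then \<mu> m / \<mu> (n + 1) * laguerre (m - (n + 1)) (\<alpha> - 1 + real (n + 1)) x else 0)
                * \<mu> (n + 1) / \<mu> n
         else 0)
      = (if n \<le> m then \<mu> m / \<mu> n * laguerre (m - n) (\<alpha> + real n) x else 0)"
  proof (cases m n rule: nat_less_eq_gt_cases)
    case (3 k)
    have "laguerre (Suc k) (\<alpha> + real n) x
        = laguerre (Suc k) (\<alpha> - 1 + real n) x + laguerre k (\<alpha> + real n) x"
      using laguerre_Suc[of k "\<alpha> - 1 + real n" x] by (simp add: algebra_simps)
    then show ?thesis
      using 3 mn assms[of "n + 1"] by (simp add: algebra_simps add_divide_distrib)
  qed (use mn in auto)
qed

text \<open>Below the diagonal this is \<open>laguerre_recurrence\<close> with parameter \<alpha> +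
  n and degree m - n = \<open>Suc k\<close>, since \<alpha> + n + \<open>Suc k\<close> = \<alpha> +
  m.\<close>

lemma Lmat_mult_Jmat_add_Amat:
  assumes "\<And>k. k \<in> {1..CARD('n)} \<Longrightarrow> \<mu> k \<noteq> 0"
  shows "Lmat \<mu> \<alpha> x ** Jmat + x *\<^sub>R (Lmat \<mu> \<alpha> x ** Amat \<mu>)
    = Jmat ** Lmat \<mu> \<alpha> x + \<alpha> *\<^sub>R (Amat \<mu> ** Lmat \<mu> \<alpha> x)
      + (Jmat ** (Amat \<mu> ** Lmat \<mu> \<alpha> x) :: 'n::{finite,linorder} sqmat)"
  unfolding Lmat_eq_rmat Amat_mult_rmat rmat_mult_Amat Jmat_eq_dmat rmat_mult_dmat dmat_mult_rmat
    rmat_scaleR rmat_add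
proof (rule rmat_cong)
  fix m n
  assume mn: "m \<in> {1..CARD('n)}" "n \<in> {1..CARD('n)}"
  show "(if n \<le> m then \<mu> m / \<mu> n * laguerre (m - n) (\<alpha> + real n) x else 0) * real n
      + x * (if n < CARD('n)
         then - (if n + 1 \<le> m
                 then \<mu> m / \<mu> (n + 1) * laguerre (m - (n + 1)) (\<alpha> + real (n + 1)) x else 0)
                * \<mu> (n + 1) / \<mu> n
         else 0)
      = real m * (if n \<le> m then \<mu> m / \<mu> n * laguerre (m - n) (\<alpha> + real n) x else 0)
      + \<alpha> * (if 1 < m then - \<mu> m / \<mu> (m - 1)
          * (if n \<le> m - 1 then \<mu> (m - 1) / \<mu> n * laguerre (m - 1 - n) (\<alpha> + real n) x else 0) else 0)
      + real m * (if 1 < m then - \<mu> m / \<mu> (m - 1)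
          * (if n \<le> m - 1 then \<mu> (m - 1) / \<mu> n * laguerre (m - 1 - n) (\<alpha> + real n) x else 0) else 0)"
  proof (cases m n rule: nat_less_eq_gt_cases)
    case (3 k)
    have "\<mu> m / \<mu> n * (real (Suc k) * laguerre (Suc k) (\<alpha> + real n) x)
        = \<mu> m / \<mu> n * ((\<alpha> + real n + real (Suc k)) * laguerre k (\<alpha> + real n) x
            - x * laguerre k (\<alpha> + real n + 1) x)"
      by (simp only: laguerre_recurrence)
    then show ?thesis
      using 3 mn assms[of "n + 1"] assms[of "m - 1"]
      by (simp add: algebra_simps add_divide_distrib)
  qed (use mn in auto)
qed

text \<open>This is exp(-x A): the diagonal matrix of the \<mu> conjugates the nilpotent shift to
  -A, so the exponential series is finite.\<close>

definition Emat :: "(nat \<Rightarrow> real) \<Rightarrow> real \<Rightarrow> 'n::{finite,linorder} sqmat" where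
  "Emat \<mu> x = rmat (\<lambda>m n. if n \<le> m then \<mu> m / \<mu> n * (x ^ (m - n) / fact (m - n)) else 0)"

lemma has_vector_derivative_Emat:
  assumes "\<And>k. k \<in> {1..CARD('n)} \<Longrightarrow> \<mu> k \<noteq> 0"
  shows "(Emat \<mu> has_vector_derivative (- (Amat \<mu> ** Emat \<mu> x) :: 'n::{finite,linorder} sqmat)) (at x)"
  unfolding Emat_def[abs_def] Amat_mult_rmat rmat_uminus
proof (rule has_vector_derivative_rmat)
  fix m n
  assume mn: "m \<in> {1..CARD('n)}" "n \<in> {1..CARD('n)}"
  show "((\<lambda>x. if n \<le> m then \<mu> m / \<mu> n * (x ^ (m - n) / fact (m - n)) else 0)
      has_real_derivative
      - (if 1 < m then - \<mu> m / \<mu> (m - 1)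
         * (if n \<le> m - 1 then \<mu> (m - 1) / \<mu> n * (x ^ (m - 1 - n) / fact (m - 1 - n)) else 0) else 0))
      (at x)"
  proof (cases m n rule: nat_less_eq_gt_cases)
    case (3 k)
    have "((\<lambda>x. x ^ Suc k / fact (Suc k)) has_real_derivative x ^ k / fact k) (at x)"
      by (rule DERIV_cong[OF DERIV_cdivide[OF DERIV_pow]]) (simp add: divide_simps)
    then have "((\<lambda>x. \<mu> m / \<mu> n * (x ^ Suc k / fact (Suc k))) has_real_derivative
        \<mu> m / \<mu> n * (x ^ k / fact k)) (at x)"
      by (rule DERIV_cmult)
    then show ?thesis
      using 3 mn assms[of "m - 1"] by (simp del: power_Suc fact_Suc)
  qed (use mn in auto)
qed

section \<open>Commutation relations of A, J and B\<close>

lemma Amat_mult_Jmat: "Amat \<mu> ** Jmat = Jmat ** Amat \<mu> - Amat \<mu>"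
  unfolding Amat_eq_rmat Jmat_eq_dmat rmat_mult_dmat dmat_mult_rmat rmat_diff
  by (rule rmat_cong) (simp add: algebra_simps add_divide_distrib)

text \<open>A, B and 2J - N - 1 form an sl2 triple in the N-dimensional irreducible representation;
  k (N - k) are its usual coefficients.\<close>

definition Bmat :: "(nat \<Rightarrow> real) \<Rightarrow> 'n::{finite,linorder} sqmat" where
  "Bmat \<mu> = rmat (\<lambda>k l. if l = k + 1 then - (real k * (real CARD('n) - real k) * \<mu> k / \<mu> l) else 0)"

lemma Amat_mult_Bmat:
  assumes "\<And>k. k \<in> {1..CARD('n)} \<Longrightarrow> \<mu> k \<noteq> 0"
  shows "Amat \<mu> ** Bmat \<mu>
    = (Bmat \<mu> ** Amat \<mu> + 2 *\<^sub>R Jmat - (real CARD('n) + 1) *\<^sub>R mat 1 :: 'n::{finite,linorder} sqmat)"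
  unfolding Bmat_def Jmat_eq_dmat mat_1_eq_rmat rmat_mult_Amat Amat_mult_rmat rmat_scaleR rmat_add
    rmat_diff
proof (rule rmat_cong)
  fix m n
  assume mn: "m \<in> {1..CARD('n)}" "n \<in> {1..CARD('n)}"
  let ?N = "real CARD('n)"
  show "(if 1 < m then - \<mu> m / \<mu> (m - 1)
          * (if n = m - 1 + 1 then - (real (m - 1) * (?N - real (m - 1)) * \<mu> (m - 1) / \<mu> n) else 0)
         else 0)
      = (if n < CARD('n)
         then - (if n + 1 = m + 1 then - (real m * (?N - real m) * \<mu> m / \<mu> (n + 1)) else 0)
            * \<mu> (n + 1) / \<mu> n
         else 0)
        + 2 * (if m = n then real m else 0) - (?N + 1) * (if m = n then 1 else 0)"
  proof (cases "m = n")
    case True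
    \<comment> \<open>The diagonal entries of AB and BA are (m-1)(N-m+1) and m(N-m). These formulas
      also hold at m = 1 and m = N respectively, where the neighbouring index leaves the range and
      the factor m - 1 or N - m vanishes.\<close>
    have "(if 1 < m then - \<mu> m / \<mu> (m - 1)
          * (if n = m - 1 + 1 then - (real (m - 1) * (?N - real (m - 1)) * \<mu> (m - 1) / \<mu> n) else 0)
         else 0) = (real m - 1) * (?N - (real m - 1))"
    proof (cases "m = 1")
      case False
      then have "\<mu> (m - 1) \<noteq> 0" "\<mu> m \<noteq> 0"
        using mn by (auto intro!: assms)
      with False show ?thesis
        using mn True by (auto simp: of_nat_diff)
    qed simp
    moreover have "(if n < CARD('n)
         then - (if n + 1 = m + 1 then - (real m * (?N - real m) * \<mu> m / \<mu> (n + 1)) else 0)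
            * \<mu> (n + 1) / \<mu> n
         else 0) = real m * (?N - real m)"
      using mn assms[of m] assms[of "m + 1"] True by (cases "m = CARD('n)") auto
    ultimately show ?thesis
      by (simp only:) (simp add: True algebra_simps)
  qed (use mn in auto)
qed

lemma has_vector_derivative_matrix_mult:
  fixes F :: "real \<Rightarrow> complex ^ 'n ^ 'm" and G :: "real \<Rightarrow> complex ^ 'k ^ 'n"
  assumes "(F has_vector_derivative F') (at x)" "(G has_vector_derivative G') (at x)"
  shows "((\<lambda>x. F x ** G x) has_vector_derivative (F x ** G' + F' ** G x)) (at x)"
  using assms by (rule matrix_mult.has_vector_derivative)

section \<open>Conjugation by the Laguerre matrix\<close>

text \<open>\<open>dim\<close> records the index type and hence N, which \<mu> and \<alpha> do not
  determine.\<close>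

locale laguerre_matrix =
  fixes \<mu> :: "nat \<Rightarrow> real" and \<alpha> :: real and dim :: "'n::{finite,linorder} itself"
  assumes mu_nonzero: "k \<in> {1..CARD('n)} \<Longrightarrow> \<mu> k \<noteq> 0"
begin

abbreviation A :: "'n sqmat" where "A \<equiv> Amat \<mu>"
abbreviation B :: "'n sqmat" where "B \<equiv> Bmat \<mu>"
abbreviation J :: "'n sqmat" where "J \<equiv> Jmat"
abbreviation L :: "real \<Rightarrow> 'n sqmat" where "L \<equiv> Lmat \<mu> \<alpha>"
abbreviation L_inv :: "real \<Rightarrow> 'n sqmat" where "L_inv x \<equiv> matrix_inv (L x)"

lemma L_inv: "L x ** L_inv x = mat 1" "L_inv x ** L x = mat 1"
proof -
  have "v = 0" if "L x *v v = 0" for v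
  proof -
    have "v $ i = 0" for i
    \<comment> \<open>Forward substitution: earlier coordinates vanish by induction, entries right
      of the diagonal are zero, and the diagonal entry is 1.\<close>
    proof (induction "idx i" arbitrary: i rule: less_induct)
      case less
      have "L x $ i $ j * v $ j = (if j = i then v $ i else 0)" for j
        using less[of j] mu_nonzero[OF idx_range, of i]
        by (cases i j rule: linorder_cases) (auto simp: Lmat_def)
      then have "(L x *v v) $ i = v $ i"
        by (simp add: matrix_vector_mult_def)
      with that show ?case
        by simp
    qed
    then show ?thesis
      by (simp add: vec_eq_iff)
  qed
  then obtain M where M: "M ** L x = mat 1"
    using matrix_left_invertible_ker[of "L x"] by blast
  then have M': "L x ** M = mat 1"
    by (rule matrix_left_right_inverse[THEN iffD1])
  then have "L_inv x = M"
    by (rule matrix_inv_eq)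
  with M M' show "L x ** L_inv x = mat 1" "L_inv x ** L x = mat 1"
    by simp_all
qed

lemmas has_vector_derivative_L =
  has_vector_derivative_Lmat[where 'n = 'n and \<mu> = \<mu>, OF mu_nonzero]

text \<open>\<^term>\<open>L x ** Emat \<mu> x\<close> is constant, so that \<^term>\<open>L_inv x\<close> is
  \<^term>\<open>Emat \<mu> x\<close> times a constant matrix.\<close>
lemma has_vector_derivative_L_inv: "(L_inv has_vector_derivative - (A ** L_inv x)) (at x)"
proof -
  let ?E = "Emat \<mu> :: real \<Rightarrow> 'n sqmat"
  have dE: "(?E has_vector_derivative - (A ** ?E x)) (at x)" for x
    by (rule has_vector_derivative_Emat) (rule mu_nonzero)
  have "((\<lambda>x. L x ** ?E x) has_vector_derivative 0) (at x)" for x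
    using has_vector_derivative_matrix_mult[OF has_vector_derivative_L dE, where x = x]
    by (simp add: matrix_mult.minus_right matrix_mul_assoc)
  then obtain C where C: "\<And>x. L x ** ?E x = C"
    using has_vector_derivative_zero_constant[of UNIV "\<lambda>x. L x ** ?E x"] by auto
  have "?E 0 = mat 1"
    unfolding Emat_def mat_1_eq_rmat by (rule rmat_cong) (auto simp: mu_nonzero)
  then have "C = L 0"
    using C[of 0] by simp
  moreover obtain M where M: "L 0 ** M = mat 1"
    using L_inv(1) ..
  ultimately have "L x ** (?E x ** M) = mat 1" for x
    by (simp add: matrix_mul_assoc C)
  then have inv: "L_inv x = ?E x ** M" for x
    by (rule matrix_inv_eq)
  show ?thesis
    unfolding inv
    using has_vector_derivative_matrix_mult[OF dE has_vector_derivative_const[of M], where x = x]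
    by (simp add: matrix_mult.minus_left matrix_mul_assoc)
qed

definition Lconj :: "real \<Rightarrow> 'n sqmat \<Rightarrow> 'n sqmat" where
  "Lconj x X = L x ** X ** L_inv x"

lemma Lconj_add: "Lconj x (X + Y) = Lconj x X + Lconj x Y"
  and Lconj_diff: "Lconj x (X - Y) = Lconj x X - Lconj x Y"
  and Lconj_scaleR: "Lconj x (r *\<^sub>R X) = r *\<^sub>R Lconj x X"
  by (simp_all add: Lconj_def matrix_distribs)

lemma Lconj_mat_1: "Lconj x (mat 1) = mat 1"
  by (simp add: Lconj_def L_inv)

lemma Lconj_mult: "Lconj x (X ** Y) = Lconj x X ** Lconj x Y"
proof -
  have "Lconj x X ** Lconj x Y = L x ** X ** (L_inv x ** L x) ** Y ** L_inv x"
    by (simp add: Lconj_def matrix_mul_assoc)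
  also have "\<dots> = Lconj x (X ** Y)"
    unfolding L_inv by (simp add: Lconj_def matrix_mul_assoc)
  finally show ?thesis ..
qed

lemma Lconj_eqI: "L x ** X = Y ** L x \<Longrightarrow> Lconj x X = Y"
  by (simp add: Lconj_def L_inv flip: matrix_mul_assoc)

lemma Lconj_J_add_A: "Lconj x (J + x *\<^sub>R A) = J + \<alpha> *\<^sub>R A + J ** A"
proof (rule Lconj_eqI)
  have "L x ** J + x *\<^sub>R (L x ** A) = J ** L x + \<alpha> *\<^sub>R (A ** L x) + J ** (A ** L x)"
    by (rule Lmat_mult_Jmat_add_Amat) (rule mu_nonzero)
  then show "L x ** (J + x *\<^sub>R A) = (J + \<alpha> *\<^sub>R A + J ** A) ** L x"
    by (simp add: matrix_mult.add_left matrix_mult.add_right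
        matrix_mult.scaleR_left matrix_mult.scaleR_right matrix_mul_assoc)
qed

text \<open>Left multiplication by A + 1 lowers \<alpha> by one in L and right multiplication by 1 -
  A restores it. This identifies the inverse of A + 1 in the Laguerre operator as a conjugate by
  L.\<close>

lemma A_plus_1_mult_Lconj: "(A + mat 1) ** Lconj x (mat 1 - A) = mat 1"
proof -
  have "(A + mat 1) ** Lconj x (mat 1 - A) = (L x + A ** L x) ** (mat 1 - A) ** L_inv x"
    by (simp add: Lconj_def matrix_mul_assoc matrix_mult.add_left add_ac)
  also have "L x + A ** L x = Lmat \<mu> (\<alpha> - 1) x"
    by (rule Lmat_add_Amat_mult) (rule mu_nonzero)
  also have "Lmat \<mu> (\<alpha> - 1) x ** (mat 1 - A) = L x"
    unfolding matrix_mult.diff_right matrix_mul_rid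
    by (rule Lmat_diff_mult_Amat) (rule mu_nonzero)
  finally show ?thesis
    by (simp add: L_inv)
qed

text \<open>The product rule with L' = L A and the derivative -A \<open>L_inv\<close> of the
  inverse; the two outer factors together produce the commutator with A.\<close>

lemma has_vector_derivative_Lconj:
  assumes "(G has_vector_derivative G') (at x)"
  shows "((\<lambda>x. Lconj x (G x)) has_vector_derivative Lconj x (A ** G x - G x ** A + G')) (at x)"
proof -
  have "((\<lambda>x. Lconj x (G x)) has_vector_derivative
     L x ** G x ** (- (A ** L_inv x)) + (L x ** G' + L x ** A ** G x) ** L_inv x) (at x)"
    unfolding Lconj_def
    by (intro has_vector_derivative_matrix_mult has_vector_derivative_L
        has_vector_derivative_L_inv assms)
  then show ?thesis
    by (simp add: Lconj_def matrix_mult.add_left matrix_mult.add_right matrix_mult.diff_left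
      matrix_mult.diff_right matrix_mult.minus_right matrix_mul_assoc add_ac)
qed

section \<open>Comparison of the conjugated coefficients\<close>

definition Kmat :: "real \<Rightarrow> 'n sqmat" where
  "Kmat s = J + s *\<^sub>R mat 1"

text \<open>Conjugated by L and multiplied by d, this is the adjoint of Psi. The term x A comes from
  differentiating the right factor of the weight, the diagonal terms from T, and B from the left
  factor.\<close>

definition Gmat :: "real \<Rightarrow> real \<Rightarrow> real \<Rightarrow> 'n sqmat" where
  "Gmat \<nu> \<rho> x = (x *\<^sub>R A + J + (\<nu> + 1 - x) *\<^sub>R mat 1) ** Kmat (\<nu> + \<rho>) + B"

lemma A_mult_Kmat: "A ** Kmat s = Kmat s ** A - A"
  by (simp add: Kmat_def matrix_distribs Amat_mult_Jmat)

lemma Lconj_Kmat_Suc: "Lconj x (Kmat (s + 1)) = Lconj x (Kmat s) + mat 1"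
  by (simp add: Kmat_def scaleR_left_distrib Lconj_add Lconj_mat_1 flip: add.assoc)

text \<open>\<open>Kmat (\<nu> + \<rho>) - x *\<^sub>R A\<close> arises from the derivative of x
  times the conjugate of K, because [A, K] = -A.\<close>

lemma first_order_coefficient:
  "Lconj x (Kmat (\<nu> + \<rho>) - x *\<^sub>R A + Gmat \<nu> \<rho> x)
    = Lconj x (Gmat (\<nu> + 1) \<rho> x) + x *\<^sub>R Lconj x (mat 1 - A) - (\<nu> + 2) *\<^sub>R mat 1
      - (J + \<alpha> *\<^sub>R A + J ** A)"
proof -
  have "Kmat (\<nu> + \<rho>) - x *\<^sub>R A + Gmat \<nu> \<rho> x
      = Gmat (\<nu> + 1) \<rho> x + x *\<^sub>R (mat 1 - A) - (\<nu> + 2) *\<^sub>R mat 1 - (J + x *\<^sub>R A)"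
    by (simp only: Gmat_def Kmat_def matrix_distribs matrix_mul_lid matrix_mul_rid)
      (simp add: vec_eq_iff scaleR_conv_of_real[where 'a = complex] algebra_simps)
  then show ?thesis
    by (simp only: Lconj_add Lconj_diff Lconj_scaleR Lconj_mat_1 flip: Lconj_J_add_A[of x])
qed

lemma zeroth_order_coefficient:
  "Lconj x (A ** Gmat \<nu> \<rho> x - Gmat \<nu> \<rho> x ** A + (A - mat 1) ** Kmat (\<nu> + \<rho>))
    = J - (\<alpha> - (\<nu> + 1)) *\<^sub>R Lconj x (mat 1 - A)
      + (\<alpha> - real CARD('n) - 2 * \<nu> - 2 - \<rho>) *\<^sub>R mat 1"
proof -
  let ?R = "Lconj x (mat 1 - A)"
  have AJ: "A ** J = J ** A - A"
    by (rule Amat_mult_Jmat)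
  have AJX: "A ** (J ** X) = J ** (A ** X) - A ** X" for X
    by (simp add: matrix_mul_assoc AJ matrix_mult.diff_left)
  have AB: "A ** B = B ** A + 2 *\<^sub>R J - (real CARD('n) + 1) *\<^sub>R mat 1"
    by (rule Amat_mult_Bmat) (rule mu_nonzero)
  \<comment> \<open>The commutators remove all products with B and move A to the right. Writing 1 +
    A as 2 - (1 - A) leaves only J + x A and 1 - A, whose conjugates by L are known.\<close>
  have "A ** Gmat \<nu> \<rho> x - Gmat \<nu> \<rho> x ** A + (A - mat 1) ** Kmat (\<nu> + \<rho>)
      = (J + x *\<^sub>R A) ** (mat 1 - A) - (\<nu> + 1) *\<^sub>R (2 *\<^sub>R mat 1 - (mat 1 - A))
        - (real CARD('n) + \<rho>) *\<^sub>R mat 1"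
    by (simp only: Gmat_def Kmat_def matrix_distribs matrix_mul_lid matrix_mul_rid AJ AJX AB
        flip: matrix_mul_assoc)
      (simp add: vec_eq_iff scaleR_conv_of_real[where 'a = complex] algebra_simps)
  then have "Lconj x (A ** Gmat \<nu> \<rho> x - Gmat \<nu> \<rho> x ** A + (A - mat 1) ** Kmat (\<nu> + \<rho>))
      = (J + \<alpha> *\<^sub>R A + J ** A) ** ?R - (\<nu> + 1) *\<^sub>R (2 *\<^sub>R mat 1 - ?R)
        - (real CARD('n) + \<rho>) *\<^sub>R mat 1"
    by (simp only: Lconj_add Lconj_diff Lconj_scaleR Lconj_mat_1 Lconj_mult flip: Lconj_J_add_A[of x])
  \<comment> \<open>Splitting off the right factor A + 1 lets it cancel against its inverse
    \<open>?R\<close>.\<close>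
  also have "J + \<alpha> *\<^sub>R A + J ** A = (J + \<alpha> *\<^sub>R mat 1) ** (A + mat 1) - \<alpha> *\<^sub>R mat 1"
    by (simp add: matrix_distribs algebra_simps)
  also have "((J + \<alpha> *\<^sub>R mat 1) ** (A + mat 1) - \<alpha> *\<^sub>R mat 1) ** ?R = J + \<alpha> *\<^sub>R mat 1 - \<alpha> *\<^sub>R ?R"
    by (simp add: matrix_mult.diff_left matrix_mult.scaleR_left A_plus_1_mult_Lconj
        flip: matrix_mul_assoc)
  finally show ?thesis
    by (simp add: algebra_simps)
qed

end

section \<open>The weight and its shift\<close>

text \<open>\<open>d\<close> and \<open>\<nu> + \<rho>\<close> play the roles of \<open>d\<^sup>(\<^sup>\<nu>\<^sup>)\<close> and \<open>c\<^sup>(\<^sup>\<nu>\<^sup>) / d\<^sup>(\<^sup>\<nu>\<^sup>)\<close> for a fixed \<open>\<nu>\<close>.\<close>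
locale laguerre_weight = laguerre_matrix \<mu> \<alpha> dim
  for \<mu> :: "nat \<Rightarrow> real" and \<alpha> :: real and dim :: "'n::{finite,linorder} itself" +
  fixes \<delta> :: "real \<Rightarrow> nat \<Rightarrow> real" and \<nu> d \<rho> :: real
  assumes delta_pos: "k \<in> {1..CARD('n)} \<Longrightarrow> \<delta> \<nu> k > 0" "k \<in> {1..CARD('n)} \<Longrightarrow> \<delta> (\<nu> + 1) k > 0"
    and delta_Suc: "k \<in> {1..CARD('n)} \<Longrightarrow> \<delta> (\<nu> + 1) k = d * (real k + (\<nu> + \<rho>)) * \<delta> \<nu> k"
    and mu_ratio: "1 \<le> k \<Longrightarrow> k < CARD('n) \<Longrightarrow>
      (\<mu> (k + 1))\<^sup>2 / (\<mu> k)\<^sup>2 = d * real k * (real CARD('n) - real k) * (\<delta> \<nu> (k + 1) / \<delta> (\<nu> + 1) k)"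
begin

abbreviation T :: "real \<Rightarrow> 'n sqmat" where "T \<equiv> Tmat \<delta> \<nu>"
abbreviation T1 :: "real \<Rightarrow> 'n sqmat" where "T1 \<equiv> Tmat \<delta> (\<nu> + 1)"
abbreviation W :: "real \<Rightarrow> 'n sqmat" where "W \<equiv> Wmat \<mu> \<delta> \<alpha> \<nu>"
abbreviation W1 :: "real \<Rightarrow> 'n sqmat" where "W1 \<equiv> Wmat \<mu> \<delta> \<alpha> (\<nu> + 1)"

abbreviation K :: "'n sqmat" where "K \<equiv> Kmat (\<nu> + \<rho>)"
abbreviation G :: "real \<Rightarrow> 'n sqmat" where "G \<equiv> Gmat \<nu> \<rho>"

lemma K_eq_dmat: "K = dmat (\<lambda>k. real k + (\<nu> + \<rho>))"
  unfolding Kmat_def Jmat_eq_dmat mat_1_eq_rmat rmat_scaleR rmat_add by (rule rmat_cong) simp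

lemma T1_eq:
  assumes "x > 0"
  shows "T1 x = (d * x) *\<^sub>R (T x ** K)"
  unfolding Tmat_eq_dmat K_eq_dmat rmat_mult_dmat rmat_scaleR using assms
  by (intro rmat_cong) (simp add: delta_Suc powr_add)

text \<open>On the subdiagonal i = j + 1 the powers of x agree, and the remaining equation is
  exactly the condition on the ratios of the \<mu>. This is how B enters, with no dependence on
  \<nu>.\<close>

lemma A_mult_T1:
  assumes "x > 0"
  shows "A ** T1 x = d *\<^sub>R (T x ** ctranspose B)"
  unfolding Tmat_eq_dmat Amat_eq_rmat Bmat_def ctranspose_rmat rmat_mult_dmat dmat_mult_rmat rmat_scaleR
proof (rule rmat_cong)
  fix i j
  assume ij: "i \<in> {1..CARD('n)}" "j \<in> {1..CARD('n)}"
  let ?N = "real CARD('n)"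
  show "(if i = j + 1 then - \<mu> i / \<mu> j else 0) * (exp (- x) * x powr (\<nu> + 1 + real j) * \<delta> (\<nu> + 1) j)
      = d * (exp (- x) * x powr (\<nu> + real i) * \<delta> \<nu> i
          * (if i = j + 1 then - (real j * (?N - real j) * \<mu> j / \<mu> i) else 0))"
  proof (cases "i = j + 1")
    case True
    have eq: "- \<mu> i / \<mu> j * \<delta> (\<nu> + 1) j
        = d * (\<delta> \<nu> i * - (real j * (?N - real j) * \<mu> j / \<mu> i))"
      using mu_ratio[of j] delta_pos(2)[of j] mu_nonzero[of j] mu_nonzero[of i] ij True
      by (simp add: field_simps power2_eq_square)
    have "- \<mu> i / \<mu> j * (exp (- x) * x powr (\<nu> + 1 + real j) * \<delta> (\<nu> + 1) j)
        = exp (- x) * x powr (\<nu> + 1 + real j) * (- \<mu> i / \<mu> j * \<delta> (\<nu> + 1) j)"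
      by simp
    also have "\<dots> = d * (exp (- x) * x powr (\<nu> + real i) * \<delta> \<nu> i
        * - (real j * (?N - real j) * \<mu> j / \<mu> i))"
      unfolding eq by (simp add: True add_ac)
    finally show ?thesis
      using True by simp
  qed simp
qed

lemma has_vector_derivative_T1:
  assumes "x > 0"
  shows "(T1 has_vector_derivative d *\<^sub>R (T x ** (K ** (J + (\<nu> + 1 - x) *\<^sub>R mat 1)))) (at x)"
proof -
  have "d *\<^sub>R (T x ** (K ** (J + (\<nu> + 1 - x) *\<^sub>R mat 1)))
     = dmat (\<lambda>k. exp (- x) * x powr (\<nu> + real k) * \<delta> (\<nu> + 1) k * (real k + (\<nu> + 1 - x)))"
    unfolding Tmat_eq_dmat K_eq_dmat Jmat_eq_dmat mat_1_eq_rmat rmat_scaleR rmat_add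
      dmat_mult_rmat
    by (rule rmat_cong) (simp add: delta_Suc)
  moreover have "(T1 has_vector_derivative
      dmat (\<lambda>k. exp (- x) * x powr (\<nu> + real k) * \<delta> (\<nu> + 1) k * (real k + (\<nu> + 1 - x)))) (at x)"
    unfolding Tmat_eq_dmat[abs_def]
  proof (rule has_vector_derivative_rmat)
    fix i j
    have powr_Suc: "x powr (\<nu> + 1 + real i) = x * x powr (\<nu> + real i)"
      using assms by (simp add: powr_add)
    have "((\<lambda>x. x powr (\<nu> + 1 + real i)) has_real_derivative
        (\<nu> + 1 + real i) * x powr (\<nu> + real i)) (at x)"
      using has_real_derivative_powr[OF assms, of "\<nu> + 1 + real i"] by (simp add: algebra_simps)
    moreover have "((\<lambda>x. exp (- x)) has_real_derivative - exp (- x)) (at x)"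
      by (auto intro!: derivative_eq_intros)
    ultimately have "((\<lambda>x. exp (- x) * x powr (\<nu> + 1 + real i) * \<delta> (\<nu> + 1) i) has_real_derivative
        (- exp (- x) * x powr (\<nu> + 1 + real i) + (\<nu> + 1 + real i) * x powr (\<nu> + real i) * exp (- x))
        * \<delta> (\<nu> + 1) i) (at x)"
      by (intro DERIV_cmult_right DERIV_mult)
    also have "(- exp (- x) * x powr (\<nu> + 1 + real i)
          + (\<nu> + 1 + real i) * x powr (\<nu> + real i) * exp (- x)) * \<delta> (\<nu> + 1) i
        = exp (- x) * x powr (\<nu> + real i) * \<delta> (\<nu> + 1) i * (real i + (\<nu> + 1 - x))"
      unfolding powr_Suc by (simp add: algebra_simps)
    finally have "((\<lambda>x. exp (- x) * x powr (\<nu> + 1 + real i) * \<delta> (\<nu> + 1) i) has_real_derivative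
        exp (- x) * x powr (\<nu> + real i) * \<delta> (\<nu> + 1) i * (real i + (\<nu> + 1 - x))) (at x)" .
    then show "((\<lambda>x. if i = j then exp (- x) * x powr (\<nu> + 1 + real i) * \<delta> (\<nu> + 1) i else 0) has_real_derivative
        (if i = j then exp (- x) * x powr (\<nu> + real i) * \<delta> (\<nu> + 1) i * (real i + (\<nu> + 1 - x)) else 0)) (at x)"
      by (cases "i = j") simp_all
  qed
  ultimately show ?thesis
    by simp
qed

lemma T_inv:
  assumes "x > 0"
  obtains T' where "T x ** T' = mat 1" "T' ** T x = mat 1"
proof -
  let ?T' = "dmat (\<lambda>k. inverse (exp (- x) * x powr (\<nu> + real k) * \<delta> \<nu> k)) :: 'n sqmat"
  have delta_nonzero: "\<delta> \<nu> k \<noteq> 0" if "k \<in> {1..CARD('n)}" for k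
    using delta_pos(1)[OF that] by simp
  have "T x ** ?T' = mat 1"
    unfolding Tmat_eq_dmat rmat_mult_dmat mat_1_eq_rmat using assms
    by (intro rmat_cong) (auto simp: delta_nonzero field_simps)
  moreover from this have "?T' ** T x = mat 1"
    by (rule matrix_left_right_inverse[THEN iffD1])
  ultimately show ?thesis
    by (rule that)
qed

text \<open>Since W is L T times the adjoint of L, the factors L and T cancel. Phi and Psi follow
  once the shifted weight and its derivative are put in this form, with X = K and X = G up to
  scalars.\<close>

lemma inv_W_mult:
  assumes "x > 0"
  shows "matrix_inv (W x) ** (L x ** (T x ** ctranspose X) ** ctranspose (L x)) = ctranspose (Lconj x X)"
proof -
  let ?L = "L x" and ?M = "L_inv x"
  obtain T' where T': "T x ** T' = mat 1" "T' ** T x = mat 1"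
    using T_inv[OF assms] .
  have "ctranspose (?M ** ?L) = mat 1" "ctranspose (?L ** ?M) = mat 1"
    by (simp_all only: L_inv ctranspose_mat_1)
  then have C: "ctranspose ?L ** ctranspose ?M = mat 1" "ctranspose ?M ** ctranspose ?L = mat 1"
    by (simp_all only: ctranspose_mult)
  have "W x ** (ctranspose ?M ** T' ** ?M)
      = ?L ** (T x ** (ctranspose ?L ** ctranspose ?M) ** T') ** ?M"
    by (simp add: Wmat_def matrix_mul_assoc)
  also have "\<dots> = mat 1"
    by (simp add: C T' L_inv)
  finally have "matrix_inv (W x) = ctranspose ?M ** T' ** ?M"
    by (rule matrix_inv_eq)
  then have "matrix_inv (W x) ** (?L ** (T x ** ctranspose X) ** ctranspose ?L)
      = ctranspose ?M ** (T' ** (?M ** ?L) ** T x) ** ctranspose X ** ctranspose ?L"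
    by (simp add: matrix_mul_assoc)
  also have "\<dots> = ctranspose (Lconj x X)"
    by (simp add: L_inv T' Lconj_def ctranspose_mult matrix_mul_assoc)
  finally show ?thesis .
qed

lemma ctranspose_K [simp]: "ctranspose K = K" and ctranspose_J [simp]: "ctranspose J = J"
  unfolding K_eq_dmat Jmat_eq_dmat ctranspose_rmat by (rule rmat_cong; simp)+

section \<open>Phi, Psi and their derivatives\<close>

lemma Phi_eq:
  assumes "x > 0"
  shows "Phi \<mu> \<delta> \<alpha> \<nu> x = (d * x) *\<^sub>R ctranspose (Lconj x K)"
proof -
  have "W1 x = (d * x) *\<^sub>R (L x ** (T x ** ctranspose K) ** ctranspose (L x))"
    by (simp add: Wmat_def T1_eq[OF assms] matrix_mult.scaleR_left matrix_mult.scaleR_right)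
  then show ?thesis
    by (simp add: Phi_def matrix_mult.scaleR_right inv_W_mult[OF assms, of K, unfolded ctranspose_K])
qed

lemma Psi_eq:
  assumes "x > 0"
  shows "Psi \<mu> \<delta> \<alpha> \<nu> x = d *\<^sub>R ctranspose (Lconj x (G x))"
proof -
  let ?T' = "d *\<^sub>R (T x ** (K ** (J + (\<nu> + 1 - x) *\<^sub>R mat 1)))"
  have W1': "(W1 has_vector_derivative
      L x ** T1 x ** ctranspose (L x ** A)
        + (L x ** ?T' + L x ** A ** T1 x) ** ctranspose (L x)) (at x)"
    unfolding Wmat_def[abs_def]
    by (rule has_vector_derivative_matrix_mult[OF
          has_vector_derivative_matrix_mult[OF has_vector_derivative_L has_vector_derivative_T1[OF assms]]
          bounded_linear.has_vector_derivative[OF bounded_linear_ctranspose has_vector_derivative_L]])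
  have "L x ** T1 x ** ctranspose (L x ** A) + (L x ** ?T' + L x ** A ** T1 x) ** ctranspose (L x)
      = L x ** (T1 x ** ctranspose A + ?T' + A ** T1 x) ** ctranspose (L x)"
    by (simp only: ctranspose_mult matrix_mult.add_left matrix_mult.add_right matrix_mul_assoc add_ac)
  \<comment> \<open>The summands on the left give, in order, the terms x A K, (J + \<nu> + 1 - x) K
    and B of \<open>G x\<close>.\<close>
  also have "T1 x ** ctranspose A + ?T' + A ** T1 x = d *\<^sub>R (T x ** ctranspose (G x))"
    unfolding A_mult_T1[OF assms] unfolding T1_eq[OF assms] Gmat_def
    by (simp add: ctranspose_add ctranspose_diff ctranspose_mult ctranspose_scaleR
        matrix_distribs matrix_mul_assoc algebra_simps)
  also have "L x ** (d *\<^sub>R (T x ** ctranspose (G x))) ** ctranspose (L x)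
      = d *\<^sub>R (L x ** (T x ** ctranspose (G x)) ** ctranspose (L x))"
    by (simp only: matrix_mult.scaleR_left matrix_mult.scaleR_right)
  finally have "(W1 has_vector_derivative
      d *\<^sub>R (L x ** (T x ** ctranspose (G x)) ** ctranspose (L x))) (at x)"
    using W1' by (simp only:)
  then have "mderiv W1 x = d *\<^sub>R (L x ** (T x ** ctranspose (G x)) ** ctranspose (L x))"
    unfolding mderiv_def by (rule vector_derivative_at)
  then show ?thesis
    by (simp only: Psi_def matrix_mult.scaleR_right inv_W_mult[OF assms])
qed

lemma mderiv_Phi:
  assumes "x > 0"
  shows "mderiv (Phi \<mu> \<delta> \<alpha> \<nu>) x = d *\<^sub>R ctranspose (Lconj x (K - x *\<^sub>R A))"
proof -
  have "((\<lambda>x. Lconj x K) has_vector_derivative - Lconj x A) (at x)"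
    using has_vector_derivative_Lconj[OF has_vector_derivative_const[of K]]
    by (simp add: A_mult_Kmat Lconj_def matrix_mult.minus_left matrix_mult.minus_right)
  then have "((\<lambda>x. (d * x) *\<^sub>R ctranspose (Lconj x K)) has_vector_derivative
      (d * x) *\<^sub>R ctranspose (- Lconj x A) + d *\<^sub>R ctranspose (Lconj x K)) (at x)"
    by (intro has_vector_derivative_scaleR bounded_linear.has_vector_derivative[OF bounded_linear_ctranspose])
      (auto intro!: derivative_eq_intros)
  also have "(d * x) *\<^sub>R ctranspose (- Lconj x A) + d *\<^sub>R ctranspose (Lconj x K)
      = d *\<^sub>R ctranspose (Lconj x (K - x *\<^sub>R A))"
    by (simp add: Lconj_diff Lconj_scaleR ctranspose_diff ctranspose_scaleR vec_eq_iff algebra_simps)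
  \<comment> \<open>\<open>Phi_eq\<close> holds only for positive arguments, so the derivative is
    transferred on the open half-line.\<close>
  finally have "(Phi \<mu> \<delta> \<alpha> \<nu> has_vector_derivative d *\<^sub>R ctranspose (Lconj x (K - x *\<^sub>R A))) (at x)"
    by (rule has_vector_derivative_transform_within_open[where S = "{0<..}"])
      (use assms Phi_eq in auto)
  then show ?thesis
    unfolding mderiv_def by (rule vector_derivative_at)
qed

lemma mderiv_Psi:
  assumes "x > 0"
  shows "mderiv (Psi \<mu> \<delta> \<alpha> \<nu>) x
    = d *\<^sub>R ctranspose (Lconj x (A ** G x - G x ** A + (A - mat 1) ** K))"
proof -
  have "(G has_vector_derivative (A - mat 1) ** K) (at x)"
  proof -
    \<comment> \<open>G is affine in x, and its slope is the claimed derivative.\<close>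
    have "G = (\<lambda>x. x *\<^sub>R ((A - mat 1) ** K) + ((J + (\<nu> + 1) *\<^sub>R mat 1) ** K + B))"
      by (rule ext) (simp add: Gmat_def matrix_distribs algebra_simps)
    then show ?thesis
      by (auto intro!: derivative_eq_intros)
  qed
  then have "((\<lambda>x. d *\<^sub>R ctranspose (Lconj x (G x))) has_vector_derivative
      d *\<^sub>R ctranspose (Lconj x (A ** G x - G x ** A + (A - mat 1) ** K))) (at x)"
    by (intro has_vector_derivative_Lconj
        bounded_linear.has_vector_derivative[OF bounded_linear_ctranspose]
        bounded_linear.has_vector_derivative[OF bounded_linear_scaleR_right])
  then have "(Psi \<mu> \<delta> \<alpha> \<nu> has_vector_derivative
      d *\<^sub>R ctranspose (Lconj x (A ** G x - G x ** A + (A - mat 1) ** K))) (at x)"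
    by (rule has_vector_derivative_transform_within_open[where S = "{0<..}"])
      (use assms Psi_eq in auto)
  then show ?thesis
    unfolding mderiv_def by (rule vector_derivative_at)
qed

end

section \<open>Comparison of the three operators\<close>

theorem proposition6p5:
  fixes N :: nat
    and \<mu> :: "nat \<Rightarrow> real"
    and \<alpha> \<nu>\<^sub>0 \<rho> :: real
    and \<delta> :: "real \<Rightarrow> nat \<Rightarrow> real"
    and c d :: "real \<Rightarrow> real"
    and V :: "real set"
  assumes "N = CARD('n::{finite,linorder})"
    and "V = {\<nu>\<^sub>0 + real k | k :: nat. True}"
    and "\<And>k. k \<in> {1..N} \<Longrightarrow> \<mu> k \<noteq> 0"
    and "\<alpha> > 0"
    and "\<nu>\<^sub>0 > 0"
    and "\<And>\<nu> k. \<nu> \<in> V \<Longrightarrow> k \<in> {1..N} \<Longrightarrow> \<delta> \<nu> k > 0"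
    and "\<And>\<nu> k. \<nu> \<in> V \<Longrightarrow> k \<in> {1..N} \<Longrightarrow> \<delta> (\<nu> + 1) k = (d \<nu> * real k + c \<nu>) * \<delta> \<nu> k"
    and "\<And>\<nu> k. \<nu> \<in> V \<Longrightarrow> 1 \<le> k \<Longrightarrow> k < N \<Longrightarrow>
           (\<mu> (k + 1))\<^sup>2 / (\<mu> k)\<^sup>2 = d \<nu> * real k * (real N - real k) * (\<delta> \<nu> (k + 1) / \<delta> (\<nu> + 1) k)"
    and "\<And>\<nu>. \<nu> \<in> V \<Longrightarrow> d \<nu> \<noteq> 0"
    and "\<And>\<nu>. \<nu> \<in> V \<Longrightarrow> c \<nu> / d \<nu> = \<nu> + \<rho>"
  shows "\<forall>\<nu>\<in>V. \<forall>P :: real \<Rightarrow> 'n sqmat. C2_on_pos P \<longrightarrow>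
           (\<forall>x>0. (1 / d \<nu>) *\<^sub>R opD_Darboux \<mu> \<delta> \<alpha> \<nu> P x =
                  (1 / d (\<nu> + 1)) *\<^sub>R opD \<mu> \<delta> \<alpha> (\<nu> + 1) P x
                  - opD_Laguerre \<mu> \<alpha> (\<nu> + 1) P x
                  + (\<alpha> - real N - 2 * \<nu> - 2 - \<rho>) *\<^sub>R P x)"
proof (intro ballI allI impI)
  fix \<nu> x :: real and P :: "real \<Rightarrow> 'n sqmat"
  assume \<nu>: "\<nu> \<in> V" and x: "x > 0"
  note N = \<open>N = CARD('n)\<close>
  have V_Suc: "\<nu>' + 1 \<in> V" if "\<nu>' \<in> V" for \<nu>'
  proof -
    obtain k where "\<nu>' = \<nu>\<^sub>0 + real k"
      using \<open>\<nu>' \<in> V\<close> assms(2) by auto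
    then have "\<nu>' + 1 = \<nu>\<^sub>0 + real (Suc k)"
      by simp
    then show ?thesis
      using assms(2) by blast
  qed
  have weight: "laguerre_weight TYPE('n) \<mu> \<delta> \<nu>' (d \<nu>') \<rho>" if \<nu>': "\<nu>' \<in> V" for \<nu>'
  proof
    fix k assume k: "k \<in> {1..CARD('n)}"
    then show "\<mu> k \<noteq> 0" "\<delta> \<nu>' k > 0" "\<delta> (\<nu>' + 1) k > 0"
      using assms(3,6) N \<nu>' V_Suc[OF \<nu>'] by simp_all
    have "c \<nu>' = d \<nu>' * (\<nu>' + \<rho>)"
      using assms(9,10)[OF \<nu>'] by (simp add: field_simps)
    then show "\<delta> (\<nu>' + 1) k = d \<nu>' * (real k + (\<nu>' + \<rho>)) * \<delta> \<nu>' k"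
      using assms(7)[OF \<nu>', of k] k N by (simp add: algebra_simps)
  next
    fix k :: nat assume "1 \<le> k" "k < CARD('n)"
    then show "(\<mu> (k + 1))\<^sup>2 / (\<mu> k)\<^sup>2
        = d \<nu>' * real k * (real CARD('n) - real k) * (\<delta> \<nu>' (k + 1) / \<delta> (\<nu>' + 1) k)"
      using assms(8)[OF \<nu>', of k] N by simp
  qed
  interpret w: laguerre_weight \<mu> \<alpha> "TYPE('n)" \<delta> \<nu> "d \<nu>" \<rho>
    using weight[OF \<nu>] .
  \<comment> \<open>The formulas are needed at \<nu> and at \<nu> + 1. Conjugation by L is the same
    in both, as L depends only on \<mu> and \<alpha>.\<close>
  interpret w1: laguerre_weight \<mu> \<alpha> "TYPE('n)" \<delta> "\<nu> + 1" "d (\<nu> + 1)" \<rho>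
    using weight[OF V_Suc[OF \<nu>]] .
  have d: "d \<nu> \<noteq> 0" "d (\<nu> + 1) \<noteq> 0"
    using assms(9) \<nu> V_Suc[OF \<nu>] by auto
  have inv: "matrix_inv (Amat \<mu> + mat 1 :: 'n sqmat) = w.Lconj x (mat 1 - Amat \<mu>)"
    by (rule matrix_inv_eq) (rule w.A_plus_1_mult_Lconj)
  \<comment> \<open>After division by d the two second-order coefficients are x times conjugates of
    K at consecutive parameters, which differ by the identity.\<close>
  have second: "(1 / d \<nu>) *\<^sub>R ctranspose (Phi \<mu> \<delta> \<alpha> \<nu> x)
      = (1 / d (\<nu> + 1)) *\<^sub>R ctranspose (Phi \<mu> \<delta> \<alpha> (\<nu> + 1) x) - x *\<^sub>R (mat 1 :: 'n sqmat)"
    using d w.Lconj_Kmat_Suc[of x "\<nu> + \<rho>"] unfolding w.Phi_eq[OF x] w1.Phi_eq[OF x]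
    by (simp add: ctranspose_scaleR scaleR_right_distrib add_ac)
  have first: "(1 / d \<nu>) *\<^sub>R (ctranspose (mderiv (Phi \<mu> \<delta> \<alpha> \<nu>) x) + ctranspose (Psi \<mu> \<delta> \<alpha> \<nu> x))
      = (1 / d (\<nu> + 1)) *\<^sub>R ctranspose (Psi \<mu> \<delta> \<alpha> (\<nu> + 1) x)
        - (- (x *\<^sub>R matrix_inv (Amat \<mu> + mat 1)) + mat (of_real (\<nu> + 1 + 1)) + Jmat
           + (mat (of_real \<alpha>) + Jmat) ** (Amat \<mu> :: 'n sqmat))"
    using d w.first_order_coefficient[of x \<nu> \<rho>]
    by (simp only: w.mderiv_Phi[OF x] w.Psi_eq[OF x] w1.Psi_eq[OF x] inv ctranspose_scaleR
        ctranspose_ctranspose w.Lconj_add mat_of_real)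
      (simp add: w.Lconj_add matrix_distribs algebra_simps scaleR_2)
  have zeroth: "(1 / d \<nu>) *\<^sub>R ctranspose (mderiv (Psi \<mu> \<delta> \<alpha> \<nu>) x)
      = (\<alpha> - real N - 2 * \<nu> - 2 - \<rho>) *\<^sub>R mat 1
        - ((\<alpha> - (\<nu> + 1)) *\<^sub>R matrix_inv (Amat \<mu> + mat 1 :: 'n sqmat) - Jmat)"
    using d by (simp add: w.mderiv_Psi[OF x] inv ctranspose_scaleR w.zeroth_order_coefficient N)
  have "(1 / d \<nu>) *\<^sub>R opD_Darboux \<mu> \<delta> \<alpha> \<nu> P x
      = mderiv (mderiv P) x ** ((1 / d \<nu>) *\<^sub>R ctranspose (Phi \<mu> \<delta> \<alpha> \<nu> x))
        + mderiv P x ** ((1 / d \<nu>) *\<^sub>R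
            (ctranspose (mderiv (Phi \<mu> \<delta> \<alpha> \<nu>) x) + ctranspose (Psi \<mu> \<delta> \<alpha> \<nu> x)))
        + P x ** ((1 / d \<nu>) *\<^sub>R ctranspose (mderiv (Psi \<mu> \<delta> \<alpha> \<nu>) x))"
    by (simp only: opD_Darboux_def scaleR_right_distrib matrix_mult.add_right matrix_mult.scaleR_right)
  also have "\<dots> = (1 / d (\<nu> + 1)) *\<^sub>R opD \<mu> \<delta> \<alpha> (\<nu> + 1) P x - opD_Laguerre \<mu> \<alpha> (\<nu> + 1) P x
      + (\<alpha> - real N - 2 * \<nu> - 2 - \<rho>) *\<^sub>R P x"
    unfolding second first zeroth
    by (simp add: opD_def opD_Laguerre_def scaleR_right_distrib matrix_mult.diff_right
        matrix_mult.scaleR_right)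
  finally show "(1 / d \<nu>) *\<^sub>R opD_Darboux \<mu> \<delta> \<alpha> \<nu> P x
      = (1 / d (\<nu> + 1)) *\<^sub>R opD \<mu> \<delta> \<alpha> (\<nu> + 1) P x - opD_Laguerre \<mu> \<alpha> (\<nu> + 1) P x
        + (\<alpha> - real N - 2 * \<nu> - 2 - \<rho>) *\<^sub>R P x" .
qed

end
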